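(* Let $A$ be a non-empty compact topological space and $B$ be a non-empty set. Let $f \colon A \times B \to \mathbb{R} \cup \{+\infty\}$ be a map that is closely convex in its first argument, closely concave in its second argument, and such that $f (\_, b)$ is lower semicontinuous for every $b \in B$. Then: $$\sup_{b \in B} \inf_{a \in A} f (a, b) = \inf_{a \in A} \sup_{b \in B} f (a, b),$$ and the infimum on the right-hand side is attained.
   Context: Compact means that every open cover has a finite subcover; no separation axiom is assumed. A map $g \colon A \to \mathbb{R}\cup\{+\infty\}$ is lower semicontinuous iff $g^{-1}(]t,+\infty])$ is open for every $t \in \mathbb{R}$. $f$ is closely convex in its first argument iff for all $a_1, a_2 \in A$, every $\alpha \in {]0, 1[}$ and every $\epsilon > 0$, there is an $a \in A$ such that, for every $b \in B$, $f (a, b) \leq \alpha f (a_1, b) + (1-\alpha) f (a_2, b) + \epsilon$. $f$ is closely concave in its second argument iff for all $b_1, b_2 \in B$, every $\alpha \in {]0, 1[}$ and all $\epsilon, M > 0$, there is a $b \in B$ such that, for every $a \in A$, $f (a, b) \geq \min (M, \alpha f (a, b_1) + (1-\alpha) f (a, b_2) - \epsilon)$. *)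

theory Defs
  imports "HOL-Analysis.Analysis"
begin

text \<open>
  Values in \<open>\<real> \<union> {+\<infinity>}\<close> are elements of \<^typ>\<open>ereal\<close> other than \<open>-\<infinity>\<close>; the exclusion of \<open>-\<infinity>\<close> is
  a separate hypothesis wherever it is needed.  All scalars below are real and embedded by
  \<^const>\<open>ereal\<close>; the coefficients are strictly positive, so \<open>0 * \<infinity>\<close> does not arise.
\<close>

definition lower_semicontinuous_map :: "'a topology \<Rightarrow> ('a \<Rightarrow> ereal) \<Rightarrow> bool" where
  "lower_semicontinuous_map X g \<longleftrightarrow> (\<forall>t::real. openin X {a \<in> topspace X. ereal t < g a})"

definition closely_convex_fst :: "'a set \<Rightarrow> 'b set \<Rightarrow> ('a \<Rightarrow> 'b \<Rightarrow> ereal) \<Rightarrow> bool" where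
  "closely_convex_fst A B f \<longleftrightarrow>
    (\<forall>a1\<in>A. \<forall>a2\<in>A. \<forall>\<alpha>::real. 0 < \<alpha> \<and> \<alpha> < 1 \<longrightarrow> (\<forall>\<epsilon>::real. \<epsilon> > 0 \<longrightarrow>
      (\<exists>a\<in>A. \<forall>b\<in>B. f a b \<le> ereal \<alpha> * f a1 b + ereal (1 - \<alpha>) * f a2 b + ereal \<epsilon>)))"

definition closely_concave_snd :: "'a set \<Rightarrow> 'b set \<Rightarrow> ('a \<Rightarrow> 'b \<Rightarrow> ereal) \<Rightarrow> bool" where
  "closely_concave_snd A B f \<longleftrightarrow>
    (\<forall>b1\<in>B. \<forall>b2\<in>B. \<forall>\<alpha>::real. 0 < \<alpha> \<and> \<alpha> < 1 \<longrightarrow> (\<forall>(\<epsilon>::real) (M::real). \<epsilon> > 0 \<and> M > 0 \<longrightarrow>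
      (\<exists>b\<in>B. \<forall>a\<in>A. f a b \<ge>
        min (ereal M) (ereal \<alpha> * f a b1 + ereal (1 - \<alpha>) * f a b2 - ereal \<epsilon>))))"

end

theory Submission
  imports Defs
begin

text \<open>
  By compactness the approximate convexity in the first argument is exact, and a real \<open>t\<close> below
  \<open>inf sup f\<close> is already exceeded pointwise by the maximum of finitely many functions \<open>f (_, b)\<close>.
  These are merged one at a time: on the set where the last function is at most \<open>t\<close>, which is again
  convex in the relevant sense, the others are merged by induction. Two functions are merged by
  separating the set of pairs dominating some \<open>(f (a, b1), f (a, b2))\<close> from a quadrant of the
  plane, which yields a convex combination to which the approximate concavity applies.
\<close>

text \<open>\<open>closely_convex_fst\<close> with \<epsilon> = 0. Without an error term, the point
  found for two members of a sublevel set stays in that set, which the induction over finite sets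
  relies on.\<close>

definition exactly_convex_fst :: "'a set \<Rightarrow> 'b set \<Rightarrow> ('a \<Rightarrow> 'b \<Rightarrow> ereal) \<Rightarrow> bool" where
  "exactly_convex_fst A B f \<longleftrightarrow>
    (\<forall>a1\<in>A. \<forall>a2\<in>A. \<forall>\<alpha>::real. 0 < \<alpha> \<and> \<alpha> < 1 \<longrightarrow>
      (\<exists>a\<in>A. \<forall>b\<in>B. f a b \<le> ereal \<alpha> * f a1 b + ereal (1 - \<alpha>) * f a2 b))"

section \<open>Compactness and lower semicontinuity\<close>

lemma compact_space_finite_subcover:
  assumes "compact_space X" and "\<And>i. i \<in> I \<Longrightarrow> openin X (U i)" and "topspace X \<subseteq> (\<Union>i\<in>I. U i)"
  obtains F where "finite F" "F \<subseteq> I" "topspace X \<subseteq> (\<Union>i\<in>F. U i)"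
proof -
  have "compactin X (topspace X)"
    using assms(1) by (simp add: compact_space_def)
  then obtain \<F> where "finite \<F>" "\<F> \<subseteq> U ` I" "topspace X \<subseteq> \<Union>\<F>"
    using compactinD[of X "topspace X" "U ` I"] assms(2,3) by auto
  then show ?thesis
    using finite_subset_image[of \<F> U I] that by metis
qed

text \<open>The bound \<open>e\<close> may be infinite, while the definition only speaks of real
  levels; the complement is the union of the superlevel sets at all real levels \<ge>
  \<open>e\<close>.\<close>

lemma closedin_lower_semicontinuous_le:
  assumes "lower_semicontinuous_map X g"
  shows "closedin X {a \<in> topspace X. g a \<le> e}"
proof -
  have iff: "\<not> g a \<le> e \<longleftrightarrow> (\<exists>t::real. e \<le> ereal t \<and> ereal t < g a)" for a
  proof
    assume "\<not> g a \<le> e"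
    then obtain t where "e < ereal t" "ereal t < g a"
      using ereal_dense2[of e "g a"] by (auto simp: not_le)
    then show "\<exists>t::real. e \<le> ereal t \<and> ereal t < g a"
      using less_imp_le by blast
  next
    assume "\<exists>t::real. e \<le> ereal t \<and> ereal t < g a"
    then show "\<not> g a \<le> e"
      using order_le_less_trans not_le by blast
  qed
  have "openin X (\<Union>t\<in>{t::real. e \<le> ereal t}. {a \<in> topspace X. ereal t < g a})"
    using assms unfolding lower_semicontinuous_map_def by blast
  also have "\<dots> = topspace X - {a \<in> topspace X. g a \<le> e}"
    using iff by blast
  finally show ?thesis
    by (simp add: closedin_def)
qed

text \<open>As \<open>g\<close> avoids -\<infinity>, its superlevel sets at real levels cover the
  space. The smallest level in a finite subcover is a lower bound.\<close>

lemma lower_semicontinuous_bounded_below: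
  assumes "compact_space X" and "lower_semicontinuous_map X g"
    and "\<And>a. a \<in> topspace X \<Longrightarrow> g a \<noteq> -\<infinity>"
  shows "\<exists>m::real. \<forall>a\<in>topspace X. ereal m \<le> g a"
proof -
  have "topspace X \<subseteq> (\<Union>t\<in>(UNIV::real set). {a \<in> topspace X. ereal t < g a})"
    using assms(3) by (auto, metis ereal_dense2 ereal_infty_less(2))
  then obtain F :: "real set" where F: "finite F" "topspace X \<subseteq> (\<Union>t\<in>F. {a \<in> topspace X. ereal t < g a})"
    using compact_space_finite_subcover[OF assms(1), of UNIV "\<lambda>t. {a \<in> topspace X. ereal t < g a}"] assms(2)
    by (auto simp: lower_semicontinuous_map_def)
  have "ereal (Min F) \<le> g a" if a: "a \<in> topspace X" for a
  proof -
    obtain t where "t \<in> F" "ereal t < g a"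
      using F(2) a by blast
    moreover have "Min F \<le> t"
      using F(1) \<open>t \<in> F\<close> by simp
    ultimately show ?thesis
      by (meson ereal_less_eq(3) less_imp_le order_trans)
  qed
  then show ?thesis by blast
qed

text \<open>The points meeting the bounds up to 1/(n+1) form a decreasing sequence of non-empty
  closed sets; a common point, given by compactness, meets them exactly. This serves both to remove
  the \<epsilon> from convexity and to attain the infimum.\<close>

lemma approximate_bound_attained:
  assumes "compact_space X" and "\<And>b. b \<in> B \<Longrightarrow> lower_semicontinuous_map X (\<lambda>a. f a b)"
    and approx: "\<And>\<epsilon>::real. 0 < \<epsilon> \<Longrightarrow> \<exists>a\<in>topspace X. \<forall>b\<in>B. f a b \<le> g b + ereal \<epsilon>"
  shows "\<exists>a\<in>topspace X. \<forall>b\<in>B. f a b \<le> g b"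
proof -
  define D where "D n = {a \<in> topspace X. \<forall>b\<in>B. f a b \<le> g b + ereal (1 / real (Suc n))}" for n :: nat
  have "closedin X (D n)" for n
  proof (cases "B = {}")
    \<comment> \<open>Only for non-empty \<open>B\<close> is \<open>D n\<close> an intersection of
      sublevel sets: an empty intersection would be the whole type instead of
      \<open>topspace X\<close>.\<close>
    case False
    then have "D n = (\<Inter>b\<in>B. {a \<in> topspace X. f a b \<le> g b + ereal (1 / real (Suc n))})"
      by (auto simp: D_def)
    with False show ?thesis
      using assms(2) by (auto intro!: closedin_lower_semicontinuous_le)
  qed (simp add: D_def)
  moreover have "D n \<noteq> {}" for n
    using approx[of "1 / real (Suc n)"] by (auto simp: D_def)
  moreover have "decseq D"
  proof (rule decseq_SucI, rule subsetI)
    fix n a assume a: "a \<in> D (Suc n)"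
    have "g b + ereal (1 / real (Suc (Suc n))) \<le> g b + ereal (1 / real (Suc n))" for b
      by (intro add_left_mono) (simp add: frac_le)
    with a show "a \<in> D n"
      unfolding D_def by (blast intro: order_trans)
  qed
  ultimately have "(\<Inter>n. D n) \<noteq> {}"
    using assms(1) by (intro compact_space_imp_nest) auto
  then obtain a where a: "\<And>n. a \<in> D n" by auto
  have "f a b \<le> g b" if "b \<in> B" for b
  proof (rule ereal_le_epsilon2)
    fix \<epsilon> :: real assume "0 < \<epsilon>"
    then obtain n where "1 / real (Suc n) < \<epsilon>"
      using nat_approx_posE by metis
    have "f a b \<le> g b + ereal (1 / real (Suc n))"
      using a[of n] that by (simp add: D_def)
    also have "\<dots> \<le> g b + ereal \<epsilon>"
      using \<open>1 / real (Suc n) < \<epsilon>\<close> by (intro add_left_mono) simp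
    finally show "f a b \<le> g b + ereal \<epsilon>" .
  qed
  then show ?thesis
    using a[of 0] by (auto simp: D_def)
qed

lemma exactly_convex_fst_if_compact:
  assumes "compact_space X" and "\<And>b. b \<in> B \<Longrightarrow> lower_semicontinuous_map X (\<lambda>a. f a b)"
    and "closely_convex_fst (topspace X) B f"
  shows "exactly_convex_fst (topspace X) B f"
  unfolding exactly_convex_fst_def
proof (intro ballI allI impI)
  fix a1 a2 :: 'a and \<alpha> :: real
  assume "a1 \<in> topspace X" "a2 \<in> topspace X" "0 < \<alpha> \<and> \<alpha> < 1"
  then have "\<exists>a\<in>topspace X. \<forall>b\<in>B. f a b \<le> ereal \<alpha> * f a1 b + ereal (1 - \<alpha>) * f a2 b + ereal \<epsilon>"
    if "0 < \<epsilon>" for \<epsilon> :: real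
    using assms(3) that unfolding closely_convex_fst_def by blast
  then show "\<exists>a\<in>topspace X. \<forall>b\<in>B. f a b \<le> ereal \<alpha> * f a1 b + ereal (1 - \<alpha>) * f a2 b"
    using approximate_bound_attained[of X B f "\<lambda>b. ereal \<alpha> * f a1 b + ereal (1 - \<alpha>) * f a2 b"] assms(1,2)
    by blast
qed

section \<open>Merging two functions by separation in the plane\<close>

text \<open>Passing from the value pairs to all real pairs above them makes the set upward closed,
  so that the inequality in exact convexity suffices for membership.\<close>

lemma convex_dominating_pairs:
  fixes f :: "'a \<Rightarrow> 'b \<Rightarrow> ereal"
  assumes "exactly_convex_fst A B f" and "b1 \<in> B" and "b2 \<in> B"
  shows "convex {(x::real, y::real). \<exists>a\<in>A. f a b1 \<le> ereal x \<and> f a b2 \<le> ereal y}"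
    (is "convex ?C")
  unfolding convex_alt
proof (intro ballI allI impI)
  fix v w :: "real \<times> real" and u :: real
  assume v: "v \<in> ?C" and w: "w \<in> ?C" and u: "0 \<le> u \<and> u \<le> 1"
  obtain x1 y1 x2 y2 where eq: "v = (x1, y1)" "w = (x2, y2)" by (cases v; cases w) auto
  show "(1 - u) *\<^sub>R v + u *\<^sub>R w \<in> ?C"
  proof (cases "u = 0 \<or> u = 1")
    case False
    then have u01: "0 < u" "u < 1" using u by auto
    from v obtain a1 where a1: "a1 \<in> A" "f a1 b1 \<le> ereal x1" "f a1 b2 \<le> ereal y1"
      by (auto simp: eq)
    from w obtain a2 where a2: "a2 \<in> A" "f a2 b1 \<le> ereal x2" "f a2 b2 \<le> ereal y2"
      by (auto simp: eq)
    have "0 < 1 - u \<and> 1 - u < 1" using u01 by simp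
    then have "\<exists>a\<in>A. \<forall>b\<in>B. f a b \<le> ereal (1 - u) * f a1 b + ereal (1 - (1 - u)) * f a2 b"
      using a1(1) a2(1) assms(1) unfolding exactly_convex_fst_def by blast
    then obtain a where a: "a \<in> A" "\<And>b. b \<in> B \<Longrightarrow> f a b \<le> ereal (1 - u) * f a1 b + ereal u * f a2 b"
      by auto
    have mono: "ereal (1 - u) * p + ereal u * q \<le> ereal ((1 - u) * r + u * s)"
      if "p \<le> ereal r" "q \<le> ereal s" for p q r s
      using add_mono[OF ereal_mult_left_mono[OF that(1), of "ereal (1 - u)"]
          ereal_mult_left_mono[OF that(2), of "ereal u"]] u01 by simp
    have "f a b1 \<le> ereal ((1 - u) * x1 + u * x2)" "f a b2 \<le> ereal ((1 - u) * y1 + u * y2)"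
      using order_trans[OF a(2)[OF assms(2)] mono[OF a1(2) a2(2)]]
        order_trans[OF a(2)[OF assms(3)] mono[OF a1(3) a2(3)]] by auto
    with a(1) show ?thesis by (auto simp: eq)
  qed (use v w in auto)
qed

text \<open>A negative slope would make \<open>p * x\<close> unbounded as x tends to -\<infinity>:
  it is d + 1 at (d + 1) / p and no smaller further left.\<close>

lemma nonneg_if_bounded_on_atMost:
  fixes p d t :: real
  assumes "\<And>x. x \<le> t \<Longrightarrow> p * x \<le> d"
  shows "0 \<le> p"
proof (rule ccontr)
  assume "\<not> 0 \<le> p"
  then have "p * ((d + 1) / p) \<le> p * min t ((d + 1) / p)"
    by (intro mult_left_mono_neg) auto
  also have "\<dots> \<le> d" by (rule assms) simp
  finally show False using \<open>\<not> 0 \<le> p\<close> by simp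
qed

text \<open>By \<open>cover\<close>, no dominating pair lies in the quadrant of pairs with both
  entries \<le> \<open>t\<close>. A separating line has a non-negative normal, whose normalised
  entries are the weights. The gap between \<open>s\<close> and \<open>t\<close> pays for making
  both weights positive.\<close>

lemma convex_combination_above:
  fixes f :: "'a \<Rightarrow> 'b \<Rightarrow> ereal" and m s t :: real
  assumes conv: "exactly_convex_fst A B f" and B: "b1 \<in> B" "b2 \<in> B"
    and bdd: "\<And>a. a \<in> A \<Longrightarrow> ereal m \<le> f a b1" "\<And>a. a \<in> A \<Longrightarrow> ereal m \<le> f a b2"
    and cover: "\<And>a. a \<in> A \<Longrightarrow> ereal t < f a b1 \<or> ereal t < f a b2" and "s < t"
  shows "\<exists>\<alpha>::real. 0 < \<alpha> \<and> \<alpha> < 1 \<and>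
    (\<forall>a\<in>A. ereal s \<le> ereal \<alpha> * f a b1 + ereal (1 - \<alpha>) * f a b2)"
proof -
  define C where "C = {(x::real, y::real). \<exists>a\<in>A. f a b1 \<le> ereal x \<and> f a b2 \<le> ereal y}"
  have "\<exists>\<alpha>::real. 0 < \<alpha> \<and> \<alpha> < 1 \<and> (\<forall>(x, y)\<in>C. m \<le> x \<longrightarrow> m \<le> y \<longrightarrow> s \<le> \<alpha> * x + (1 - \<alpha>) * y)"
  proof (cases "C = {}")
    \<comment> \<open>Here at every point of \<open>A\<close> one of the two values is +\<infinity>,
      so any weight strictly between 0 and 1 will do.\<close>
    case True
    then show ?thesis by (intro exI[of _ "1 / 2"]) auto
  next
    case False
    have "({..t} \<times> {..t}) \<inter> C = {}"
    proof -
      have False if "x \<le> t" "y \<le> t" "a \<in> A" "f a b1 \<le> ereal x" "f a b2 \<le> ereal y" for x y a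
        using cover[OF that(3)] that by (meson ereal_less_eq(3) not_le order_trans)
      then show ?thesis by (auto simp: C_def)
    qed
    moreover have "convex ({..t} \<times> {..t})" by (intro convex_Times) auto
    moreover have "convex C"
      unfolding C_def by (rule convex_dominating_pairs[OF conv B])
    ultimately obtain c d where c: "c \<noteq> 0" and below: "\<forall>z\<in>{..t} \<times> {..t}. inner c z \<le> d"
      and above: "\<forall>z\<in>C. d \<le> inner c z"
      using separating_hyperplane_sets[of "{..t} \<times> {..t}" C] False by auto
    obtain p q where pq: "c = (p, q)" by (cases c)
    have below': "p * x + q * y \<le> d" if "x \<le> t" "y \<le> t" for x y
      using below that by (auto simp: pq)
    \<comment> \<open>The quadrant extends to -\<infinity> in each coordinate, so an upper bound for
      the functional on it forces non-negative coefficients.\<close>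
    have "0 \<le> p"
      using below'[of _ t] by (intro nonneg_if_bounded_on_atMost[of t p "d - q * t"]) (simp add: le_diff_eq)
    moreover have "0 \<le> q"
      using below'[of t] by (intro nonneg_if_bounded_on_atMost[of t q "d - p * t"]) (simp add: le_diff_eq add.commute)
    ultimately have pos: "0 < p + q" using c pq by (auto simp: zero_prod_def add_nonneg_eq_0_iff less_le)
    define \<beta> where "\<beta> = p / (p + q)"
    have \<beta>: "0 \<le> \<beta>" "\<beta> \<le> 1" using \<open>0 \<le> p\<close> \<open>0 \<le> q\<close> pos by (auto simp: \<beta>_def)
    have C_above: "t \<le> \<beta> * x + (1 - \<beta>) * y" if "(x, y) \<in> C" for x y
    proof -
      \<comment> \<open>The separation is evaluated at the corner (t, t) of the quadrant.\<close>
      have "(p + q) * t \<le> p * x + q * y"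
        using below'[of t t] above that by (force simp: pq distrib_right)
      moreover have "\<beta> * (p + q) = p" "(1 - \<beta>) * (p + q) = q"
        using pos by (auto simp: \<beta>_def field_simps)
      then have "p * x + q * y = (p + q) * (\<beta> * x + (1 - \<beta>) * y)"
        by (metis (no_types, lifting) distrib_left mult.commute mult.left_commute)
      ultimately show ?thesis using pos by simp
    qed
    txt \<open>\<open>\<beta>\<close> may be 0 or 1, so it is moved into the interior; the lower bound \<open>m\<close> controls the loss.\<close>
    define \<delta> where "\<delta> = min (1 / 2) ((t - s) / (1 + \<bar>t - m\<bar>))"
    have "\<delta> \<le> (t - s) / (1 + \<bar>t - m\<bar>)" by (simp add: \<delta>_def)
    then have "\<delta> * (1 + \<bar>t - m\<bar>) \<le> t - s"
      by (simp add: pos_le_divide_eq)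
    moreover have "0 < \<delta>" "\<delta> < 1"
      using \<open>s < t\<close> by (auto simp: \<delta>_def)
    ultimately have \<delta>: "0 < \<delta>" "\<delta> < 1" "\<delta> * (1 + \<bar>t - m\<bar>) \<le> t - s" by auto
    have "\<delta> * (t - m) \<le> \<delta> * (1 + \<bar>t - m\<bar>)"
      using \<delta>(1) by (intro mult_left_mono) auto
    then have loss: "s \<le> (1 - \<delta>) * t + \<delta> * m"
      using \<delta>(3) by (simp add: algebra_simps)
    \<comment> \<open>\<open>\<alpha>\<close> mixes \<open>\<beta>\<close> with 1/2, the latter with
      weight \<open>\<delta>\<close>. Accordingly the combination mixes one that is at least
      \<open>t\<close> with the mean (x + y) / 2, which is at least \<open>m\<close>.\<close>
    define \<alpha> where "\<alpha> = (1 - \<delta>) * \<beta> + \<delta> / 2"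
    have "(1 - \<delta>) * \<beta> \<le> 1 - \<delta>" "0 \<le> (1 - \<delta>) * \<beta>"
      using \<beta> \<delta> by (auto simp: mult_left_le)
    then have "0 < \<alpha>" "\<alpha> < 1" unfolding \<alpha>_def using \<delta>(1) by linarith+
    moreover have "s \<le> \<alpha> * x + (1 - \<alpha>) * y" if "(x, y) \<in> C" "m \<le> x" "m \<le> y" for x y
    proof -
      have "(1 - \<delta>) * t + \<delta> * m \<le> (1 - \<delta>) * (\<beta> * x + (1 - \<beta>) * y) + \<delta> * ((x + y) / 2)"
        using C_above[OF that(1)] that \<delta> by (intro add_mono mult_left_mono) auto
      also have "\<dots> = \<alpha> * x + (1 - \<alpha>) * y"
        by (simp add: \<alpha>_def field_simps)
      finally show ?thesis using loss by linarith
    qed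
    ultimately show ?thesis by auto
  qed
  then obtain \<alpha> where \<alpha>: "0 < \<alpha>" "\<alpha> < 1"
    and le: "\<And>x y. (x, y) \<in> C \<Longrightarrow> m \<le> x \<Longrightarrow> m \<le> y \<Longrightarrow> s \<le> \<alpha> * x + (1 - \<alpha>) * y"
    by blast
  \<comment> \<open>If both values are real, they form a pair in \<open>C\<close>. Otherwise one is
    +\<infinity>, as \<open>bdd\<close> excludes -\<infinity>, and positive weights make the
    combination +\<infinity>.\<close>
  have "ereal s \<le> ereal \<alpha> * f a b1 + ereal (1 - \<alpha>) * f a b2" if a: "a \<in> A" for a
    using le bdd(1)[OF a] bdd(2)[OF a] a \<alpha>
    by (cases "f a b1"; cases "f a b2") (fastforce simp: C_def)+
  with \<alpha> show ?thesis by blast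
qed

text \<open>The gap between \<open>r\<close> and \<open>t\<close> is spent in two portions: from
  \<open>t\<close> to \<open>s\<close> for the convex combination, from \<open>s\<close> to
  \<open>r\<close> for the error in approximate concavity.\<close>

lemma merge_two:
  fixes f :: "'a \<Rightarrow> 'b \<Rightarrow> ereal" and r t :: real
  assumes "exactly_convex_fst A B f" and "closely_concave_snd A B f"
    and bdd: "\<And>b. b \<in> B \<Longrightarrow> \<exists>m::real. \<forall>a\<in>A. ereal m \<le> f a b"
    and B: "b1 \<in> B" "b2 \<in> B"
    and "\<And>a. a \<in> A \<Longrightarrow> ereal t < f a b1 \<or> ereal t < f a b2" and "r < t"
  shows "\<exists>b\<in>B. \<forall>a\<in>A. ereal r < f a b"
proof -
  obtain m1 m2 where m: "\<And>a. a \<in> A \<Longrightarrow> ereal m1 \<le> f a b1" "\<And>a. a \<in> A \<Longrightarrow> ereal m2 \<le> f a b2"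
    using bdd B by meson
  have "ereal (min m1 m2) \<le> f a b1" "ereal (min m1 m2) \<le> f a b2" if "a \<in> A" for a
    using m that by (meson ereal_less_eq(3) min.cobounded1 min.cobounded2 order_trans)+
  moreover obtain s where s: "r < s" "s < t" using dense[OF \<open>r < t\<close>] by blast
  ultimately obtain \<alpha> where \<alpha>: "0 < \<alpha>" "\<alpha> < 1"
    and comb: "\<And>a. a \<in> A \<Longrightarrow> ereal s \<le> ereal \<alpha> * f a b1 + ereal (1 - \<alpha>) * f a b2"
    using convex_combination_above[OF assms(1) B _ _ assms(6), of "min m1 m2" s] by blast
  define \<epsilon> where "\<epsilon> = (s - r) / 2"
  \<comment> \<open>The cap \<open>max 1 s\<close> is positive, as concavity demands, and at least
    \<open>s\<close>, so the minimum with it does not fall below \<open>s - \<epsilon>\<close>, the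
    midpoint of \<open>r\<close> and \<open>s\<close>.\<close>
  have "\<epsilon> > 0" "(max 1 s) > 0" using s by (auto simp: \<epsilon>_def)
  with \<alpha> B assms(2) obtain b where b: "b \<in> B" "\<And>a. a \<in> A \<Longrightarrow>
      f a b \<ge> min (ereal (max 1 s)) (ereal \<alpha> * f a b1 + ereal (1 - \<alpha>) * f a b2 - ereal \<epsilon>)"
    unfolding closely_concave_snd_def by meson
  have "ereal r < f a b" if "a \<in> A" for a
  proof -
    have "ereal r < ereal (s - \<epsilon>)" using s by (simp add: \<epsilon>_def field_simps)
    also have "\<dots> \<le> min (ereal (max 1 s)) (ereal \<alpha> * f a b1 + ereal (1 - \<alpha>) * f a b2 - ereal \<epsilon>)"
    proof (rule min.boundedI)
      show "ereal (s - \<epsilon>) \<le> ereal (max 1 s)"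
        using \<open>\<epsilon> > 0\<close> unfolding ereal_less_eq by simp
      show "ereal (s - \<epsilon>) \<le> ereal \<alpha> * f a b1 + ereal (1 - \<alpha>) * f a b2 - ereal \<epsilon>"
        using ereal_minus_mono[OF comb[OF that], of "ereal \<epsilon>" "ereal \<epsilon>"] by simp
    qed
    also have "\<dots> \<le> f a b" using b(2)[OF that] .
    finally show ?thesis .
  qed
  with b(1) show ?thesis by blast
qed

section \<open>Merging finitely many functions\<close>

lemma exactly_convex_fst_sublevel:
  assumes conv: "exactly_convex_fst A B f" and "b \<in> B"
  shows "exactly_convex_fst {a \<in> A. f a b \<le> ereal t} B f"
  unfolding exactly_convex_fst_def
proof (intro ballI allI impI)
  fix a1 a2 :: 'a and \<alpha> :: real
  assume a1: "a1 \<in> {a \<in> A. f a b \<le> ereal t}" and a2: "a2 \<in> {a \<in> A. f a b \<le> ereal t}"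
    and \<alpha>: "0 < \<alpha> \<and> \<alpha> < 1"
  then obtain a where a: "a \<in> A" "\<forall>b\<in>B. f a b \<le> ereal \<alpha> * f a1 b + ereal (1 - \<alpha>) * f a2 b"
    using conv unfolding exactly_convex_fst_def by blast
  have "ereal \<alpha> * f a1 b + ereal (1 - \<alpha>) * f a2 b \<le> ereal \<alpha> * ereal t + ereal (1 - \<alpha>) * ereal t"
    using a1 a2 \<alpha> by (intro add_mono ereal_mult_left_mono) auto
  also have "\<dots> = ereal t" by (simp add: algebra_simps)
  finally have "f a b \<le> ereal t" using a(2) \<open>b \<in> B\<close> order_trans by blast
  with a show "\<exists>a\<in>{a \<in> A. f a b \<le> ereal t}. \<forall>b\<in>B. f a b \<le> ereal \<alpha> * f a1 b + ereal (1 - \<alpha>) * f a2 b"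
    by blast
qed

lemma closely_concave_snd_subset:
  assumes "closely_concave_snd A B f" and "A' \<subseteq> A"
  shows "closely_concave_snd A' B f"
  unfolding closely_concave_snd_def
proof (intro ballI allI impI)
  fix b1 b2 :: 'b and \<alpha> \<epsilon> M :: real
  assume "b1 \<in> B" "b2 \<in> B" "0 < \<alpha> \<and> \<alpha> < 1" "\<epsilon> > 0 \<and> M > 0"
  then have "\<exists>b\<in>B. \<forall>a\<in>A. f a b \<ge>
      min (ereal M) (ereal \<alpha> * f a b1 + ereal (1 - \<alpha>) * f a b2 - ereal \<epsilon>)"
    using assms(1) unfolding closely_concave_snd_def by blast
  with assms(2) show "\<exists>b\<in>B. \<forall>a\<in>A'. f a b \<ge>
      min (ereal M) (ereal \<alpha> * f a b1 + ereal (1 - \<alpha>) * f a b2 - ereal \<epsilon>)"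
    by blast
qed

text \<open>The induction keeps \<open>t\<close> fixed but varies \<open>A\<close> and
  \<open>r\<close>: the hypothesis is applied on a smaller set and at a level closer to
  \<open>t\<close>.\<close>

lemma merge_finite:
  fixes f :: "'a \<Rightarrow> 'b \<Rightarrow> ereal" and r t :: real
  assumes "finite S" "S \<noteq> {}" "S \<subseteq> B"
    and "exactly_convex_fst A B f" and "closely_concave_snd A B f"
    and "\<And>b. b \<in> B \<Longrightarrow> \<exists>m::real. \<forall>a\<in>A. ereal m \<le> f a b"
    and "\<And>a. a \<in> A \<Longrightarrow> \<exists>b\<in>S. ereal t < f a b" and "r < t"
  shows "\<exists>b\<in>B. \<forall>a\<in>A. ereal r < f a b"
  using assms
proof (induction S arbitrary: A r rule: finite_ne_induct)
  case (singleton b)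
  then have "\<forall>a\<in>A. ereal r < f a b"
    by (metis less_ereal.simps(1) order_less_trans singletonD)
  with singleton show ?case by blast
next
  case (insert c S)
  \<comment> \<open>Off \<open>A'\<close> the function of \<open>c\<close> already exceeds
    \<open>t\<close>; on \<open>A'\<close> it does not, so \<open>S\<close> alone must cover
    there.\<close>
  define A' where "A' = {a \<in> A. f a c \<le> ereal t}"
  \<comment> \<open>The induction hypothesis descends from \<open>t\<close> to \<open>s\<close> on
    \<open>A'\<close>; \<open>merge_two\<close> then descends from \<open>s\<close> to
    \<open>r\<close> on all of \<open>A\<close>.\<close>
  obtain s where s: "r < s" "s < t" using dense[OF \<open>r < t\<close>] by blast
  have c: "c \<in> B" using insert.prems(1) by simp
  have "\<exists>b\<in>B. \<forall>a\<in>A'. ereal s < f a b"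
  proof (rule insert.IH)
    show "exactly_convex_fst A' B f"
      unfolding A'_def using insert.prems(2) c by (rule exactly_convex_fst_sublevel)
    show "closely_concave_snd A' B f"
      using insert.prems(3) by (rule closely_concave_snd_subset) (auto simp: A'_def)
    show "\<exists>m::real. \<forall>a\<in>A'. ereal m \<le> f a b" if "b \<in> B" for b
      using insert.prems(4)[OF that] by (auto simp: A'_def)
    show "\<exists>b\<in>S. ereal t < f a b" if "a \<in> A'" for a
      using insert.prems(5)[of a] that by (auto simp: A'_def)
  qed (use insert.prems s in auto)
  then obtain b where b: "b \<in> B" "\<And>a. a \<in> A' \<Longrightarrow> ereal s < f a b" by blast
  have "ereal s < f a b \<or> ereal s < f a c" if "a \<in> A" for a
  proof (cases "a \<in> A'")
    case False
    then have "ereal t < f a c" using that by (simp add: A'_def)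
    then show ?thesis using s by (meson less_ereal.simps(1) order_less_trans)
  qed (use b in blast)
  then show ?case
    using merge_two[OF insert.prems(2,3,4) b(1) c] s by blast
qed

section \<open>Minimax equality and attainment\<close>

theorem theorem14p5:
  fixes X :: "'a topology" and B :: "'b set" and f :: "'a \<Rightarrow> 'b \<Rightarrow> ereal"
  assumes "compact_space X" and "topspace X \<noteq> {}" and "B \<noteq> {}"
    and "\<And>a b. a \<in> topspace X \<Longrightarrow> b \<in> B \<Longrightarrow> f a b \<noteq> -\<infinity>"
    and "closely_convex_fst (topspace X) B f"
    and "closely_concave_snd (topspace X) B f"
    and "\<And>b. b \<in> B \<Longrightarrow> lower_semicontinuous_map X (\<lambda>a. f a b)"
  shows "(SUP b\<in>B. INF a\<in>topspace X. f a b) = (INF a\<in>topspace X. SUP b\<in>B. f a b)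
    \<and> (\<exists>a0\<in>topspace X. (SUP b\<in>B. f a0 b) = (INF a\<in>topspace X. SUP b\<in>B. f a b))"
proof
  have bdd: "\<exists>m::real. \<forall>a\<in>topspace X. ereal m \<le> f a b" if "b \<in> B" for b
    using assms(4) that by (intro lower_semicontinuous_bounded_below[OF assms(1) assms(7)]) auto
  let ?L = "SUP b\<in>B. INF a\<in>topspace X. f a b" and ?R = "INF a\<in>topspace X. SUP b\<in>B. f a b"
  show "?L = ?R"
  proof (rule antisym)
    show "?L \<le> ?R"
      by (intro SUP_least INF_greatest) (meson INF_lower SUP_upper order_trans)
    show "?R \<le> ?L"
    proof (rule ccontr)
      \<comment> \<open>Two reals \<open>r < t\<close> are placed strictly between the sides. The
        cover exists at level \<open>t\<close>; merging yields one \<open>b\<close> whose function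
        stays above \<open>r\<close>, although \<open>?L\<close> is below \<open>r\<close>.\<close>
      assume "\<not> ?R \<le> ?L"
      then obtain r where r: "?L < ereal r" "ereal r < ?R"
        using ereal_dense2 by (metis not_le)
      then obtain t where t: "ereal r < ereal t" "ereal t < ?R"
        using ereal_dense2 by blast
      have cover: "\<exists>b\<in>B. ereal t < f a b" if "a \<in> topspace X" for a
        using less_le_trans[OF t(2) INF_lower[OF that]] by (simp add: less_SUP_iff)
      then have "topspace X \<subseteq> (\<Union>b\<in>B. {a \<in> topspace X. ereal t < f a b})" by auto
      then obtain S where S: "finite S" "S \<subseteq> B" "topspace X \<subseteq> (\<Union>b\<in>S. {a \<in> topspace X. ereal t < f a b})"
        using compact_space_finite_subcover[OF assms(1), of B "\<lambda>b. {a \<in> topspace X. ereal t < f a b}"]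
          assms(7) by (auto simp: lower_semicontinuous_map_def)
      have "exactly_convex_fst (topspace X) B f"
        using assms by (intro exactly_convex_fst_if_compact)
      moreover have "S \<noteq> {}" using S(3) assms(2) by auto
      ultimately obtain b where "b \<in> B" "\<forall>a\<in>topspace X. ereal r < f a b"
        using merge_finite[OF S(1) _ S(2) _ assms(6) bdd, of t r] S(3) t(1) by auto
      then have "ereal r \<le> (INF a\<in>topspace X. f a b)"
        by (intro INF_greatest) (simp add: less_imp_le)
      with \<open>b \<in> B\<close> have "ereal r \<le> ?L" by (rule SUP_upper2)
      with r(1) show False by simp
    qed
  qed
  show "\<exists>a0\<in>topspace X. (SUP b\<in>B. f a0 b) = ?R"
  proof -
    \<comment> \<open>Attainment is \<open>approximate_bound_attained\<close> with the constant
      bound \<open>?R\<close>, whose approximate solutions come from the definition of the infimum.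
      For \<open>?R\<close> = \<infinity> every point qualifies.\<close>
    have "\<exists>a\<in>topspace X. \<forall>b\<in>B. f a b \<le> ?R"
    proof (cases "?R = \<infinity>")
      case True
      moreover obtain a where "a \<in> topspace X" using assms(2) by blast
      ultimately show ?thesis by auto
    next
      case False
      \<comment> \<open>The lower bound of a single function keeps \<open>?R\<close> away from
        -\<infinity>. Finiteness is what makes \<open>?R < ?R + \<epsilon>\<close> strict.\<close>
      obtain b m where "b \<in> B" and m: "\<forall>a\<in>topspace X. ereal m \<le> f a b"
        using bdd assms(3) by blast
      then have "ereal m \<le> ?R"
        by (intro INF_greatest) (auto intro: SUP_upper2)
      with False have fin: "\<bar>?R\<bar> \<noteq> \<infinity>" by auto
      show ?thesis
      proof (rule approximate_bound_attained[OF assms(1,7)])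
        fix \<epsilon> :: real assume "0 < \<epsilon>"
        then have "?R < ?R + ereal \<epsilon>"
          using fin by (cases ?R) auto
        then obtain a where "a \<in> topspace X" "(SUP b\<in>B. f a b) < ?R + ereal \<epsilon>"
          unfolding INF_less_iff by blast
        then show "\<exists>a\<in>topspace X. \<forall>b\<in>B. f a b \<le> ?R + ereal \<epsilon>"
          by (meson SUP_upper less_imp_le order_trans)
      qed
    qed
    then show ?thesis
      by (metis (no_types, lifting) INF_lower SUP_least antisym)
  qed
qed

end
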